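(* Let $(X,H)$ be a permutation group with $|X|=n$ finite, let $G$ be a group, and let $(Y,G)$ be any permutation group with group $G$. Then the permutation wreath product $H\ltimes_\theta G^n$ of the permutation group $(X,H)$ and the group $G$ is isomorphic, as a group, to the group $\mathcal{C}_{[(X,H),(Y,G)]}$ acting in the full cascade product of $(X,H)$ and $(Y,G)$.
   Context: A permutation group $(X,G)$ consists of a set $X$ and a group $G$ acting on $X$ on the right, written $x^g$, so that $x^1=x$ and $(x^g)^h=x^{gh}$ for all $x\in X$, $g,h\in G$. Semidirect product: given groups $H$, $N$ and a homomorphism $\theta:H\to\mathrm{Aut}(N)$, $h\mapsto\theta_h$, the group $H\ltimes_\theta N$ is the set of ordered pairs $\{(h,n)\mid h\in H,\ n\in N\}$ with multiplication $(h_1,n_1)(h_2,n_2)=(h_1h_2,\ n_1\theta_{h_1}(n_2))$. Permutation wreath product: given a permutation group $(X,H)$ with $n=|X|$ (identify $X$ with $\{1,\ldots,n\}$) and a group $G$, the permutation wreath product is the semidirect product $H\ltimes_\theta G^n$, where $\theta:H\to\mathrm{Aut}(G^n)$ sends $h$ to the automorphism $\theta_h$ permuting the direct factors by $$\theta_h(g_1,g_2,\ldots,g_n)=(g_{(1^h)},g_{(2^h)},\ldots,g_{(n^h)}).$$ Full cascade product: for an ordered list $L=[(X_1,G_1),\ldots,(X_m,G_m)]$ of permutation groups, a dependency function of level $i$ is an arbitrary function $d_i:X_1\times\cdots\times X_{i-1}\to G_i$ (for $i=1$ this is just an element $d_1(\varnothing)$ of $G_1$), and a permutation cascade for $L$ is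 a tuple $d=(d_1,\ldots,d_m)$ with $d_i$ a dependency function of level $i$. It acts on $X_1\times\cdots\times X_m$ by $(x_1,\ldots,x_m)^d=(x_1^d,\ldots,x_m^d)$ with $x_i^d:=x_i^{d_i(x_1,\ldots,x_{i-1})}$. The set $\mathcal{C}_L$ of all permutation cascades for $L$ is a group under the multiplication $$(df)_i(x_1,\ldots,x_{i-1})=d_i(x_1,\ldots,x_{i-1})\,f_i\left(x_1^d,\ldots,x_{i-1}^d\right),$$ and the full cascade product of $L$ is the permutation group $(X_1\times\cdots\times X_m,\mathcal{C}_L)$. In particular, for $L=[(X,H),(Y,G)]$ the elements of $\mathcal{C}_L$ are the pairs $(h,f)$ with $h\in H$ and $f:X\to G$ an arbitrary function, with product $(h,f)(h',f')=(hh',\ x\mapsto f(x)f'(x^h))$. *)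

theory Defs
  imports "HOL-Algebra.Algebra"
begin

record ('x, 'g) perm_group =
  points :: "'x set"
  grp :: "'g monoid"
  act :: "'x \<Rightarrow> 'g \<Rightarrow> 'x"

text \<open>A permutation group is a group acting on the right on its set of points; the action is
  not required to be faithful, and the set of points may be empty or infinite.\<close>

definition permutation_group :: "('x, 'g) perm_group \<Rightarrow> bool" where
  "permutation_group P \<longleftrightarrow>
     group (grp P) \<and>
     (\<forall>x \<in> points P. \<forall>g \<in> carrier (grp P). act P x g \<in> points P) \<and>
     (\<forall>x \<in> points P. act P x \<one>\<^bsub>grp P\<^esub> = x) \<and>
     (\<forall>x \<in> points P. \<forall>g \<in> carrier (grp P). \<forall>h \<in> carrier (grp P).
        act P (act P x g) h = act P x (g \<otimes>\<^bsub>grp P\<^esub> h))"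

definition semidirect_product ::
    "'h monoid \<Rightarrow> ('h \<Rightarrow> 'n \<Rightarrow> 'n) \<Rightarrow> 'n monoid \<Rightarrow> ('h \<times> 'n) monoid" where
  "semidirect_product H \<theta> N =
     \<lparr> carrier = carrier H \<times> carrier N,
       monoid.mult = (\<lambda>(h1, n1) (h2, n2). (h1 \<otimes>\<^bsub>H\<^esub> h2, n1 \<otimes>\<^bsub>N\<^esub> \<theta> h1 n2)),
       one = (\<one>\<^bsub>H\<^esub>, \<one>\<^bsub>N\<^esub>) \<rparr>"

definition direct_power :: "nat \<Rightarrow> 'g monoid \<Rightarrow> (nat \<Rightarrow> 'g) monoid" where
  "direct_power n G = product_group {1..n} (\<lambda>_. G)"

text \<open>The bijection \<open>e\<close> from \<open>{1..n}\<close> to the points of \<open>P\<close> is the identification of the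
  points with \<open>1, \<dots>, n\<close>. The \<open>i\<close>-th entry of \<open>factor_perm P e G h g\<close> is the entry of \<open>g\<close> at
  \<open>i\<close> moved by \<open>h\<close>. The function is restricted to the carrier because elements of the
  library's \<open>AutoGroup\<close> are extensional.\<close>

definition factor_perm ::
    "('x, 'h) perm_group \<Rightarrow> (nat \<Rightarrow> 'x) \<Rightarrow> 'g monoid \<Rightarrow> 'h \<Rightarrow> (nat \<Rightarrow> 'g) \<Rightarrow> (nat \<Rightarrow> 'g)" where
  "factor_perm P e G h =
     (let n = card (points P) in
      (\<lambda>g \<in> carrier (direct_power n G). \<lambda>i \<in> {1..n}. g (inv_into {1..n} e (act P (e i) h))))"

definition wreath_product ::
    "('x, 'h) perm_group \<Rightarrow> (nat \<Rightarrow> 'x) \<Rightarrow> 'g monoid \<Rightarrow> ('h \<times> (nat \<Rightarrow> 'g)) monoid" where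
  "wreath_product P e G =
     semidirect_product (grp P) (factor_perm P e G) (direct_power (card (points P)) G)"

text \<open>The full cascade product of the two-term list \<open>[P, Q]\<close>. A level-one dependency function
  is an element of \<open>grp P\<close>; a level-two one is an arbitrary function from \<open>points P\<close> to the
  group of \<open>Q\<close>, represented extensionally so that equality is equality on \<open>points P\<close>.\<close>

definition cascade_product ::
    "('x, 'h) perm_group \<Rightarrow> ('y, 'g) perm_group \<Rightarrow> ('x \<times> 'y, 'h \<times> ('x \<Rightarrow> 'g)) perm_group" where
  "cascade_product P Q =
     \<lparr> points = points P \<times> points Q,
       grp =
         \<lparr> carrier = carrier (grp P) \<times> (points P \<rightarrow>\<^sub>E carrier (grp Q)),
           monoid.mult = (\<lambda>(h, f) (h', f').
             (h \<otimes>\<^bsub>grp P\<^esub> h', \<lambda>x \<in> points P. f x \<otimes>\<^bsub>grp Q\<^esub> f' (act P x h))),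
           one = (\<one>\<^bsub>grp P\<^esub>, \<lambda>x \<in> points P. \<one>\<^bsub>grp Q\<^esub>) \<rparr>,
       act = (\<lambda>(x, y) (h, f). (act P x h, act Q y (f x))) \<rparr>"

lemma group_direct_power: "group G \<Longrightarrow> group (direct_power n G)"
  by (simp add: direct_power_def)

lemma group_semidirect_product:
  assumes "group H" "group N" and \<theta>: "\<theta> \<in> hom H (AutoGroup N)"
  shows "group (semidirect_product H \<theta> N)"
proof -
  interpret H: group H by fact
  interpret N: group N by fact
  interpret T: group_hom H "AutoGroup N" \<theta>
    using \<theta> N.AutoGroup by (simp add: group_hom_def group_hom_axioms_def H.is_group)
  have aut: "\<theta> h \<in> hom N N" if "h \<in> carrier H" for h
    using T.hom_closed[OF that] by (simp add: AutoGroup_def auto_def)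
  have closed: "\<theta> h n \<in> carrier N" if "h \<in> carrier H" "n \<in> carrier N" for h n
    using aut[OF that(1)] that(2) by (auto simp: hom_def)
  have mult: "\<theta> h (m \<otimes>\<^bsub>N\<^esub> n) = \<theta> h m \<otimes>\<^bsub>N\<^esub> \<theta> h n"
    if "h \<in> carrier H" "m \<in> carrier N" "n \<in> carrier N" for h m n
    using aut[OF that(1)] that(2,3) by (auto simp: hom_def)
  have comp: "\<theta> (h \<otimes>\<^bsub>H\<^esub> k) n = \<theta> h (\<theta> k n)"
    if "h \<in> carrier H" "k \<in> carrier H" "n \<in> carrier N" for h k n
    using T.hom_mult[OF that(1,2)] that T.hom_closed[of h] T.hom_closed[of k]
    by (simp add: AutoGroup_def BijGroup_def auto_def restrict_def compose_def)
  have one: "\<theta> \<one>\<^bsub>H\<^esub> n = n" if "n \<in> carrier N" for n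
    using T.hom_one that by (simp add: AutoGroup_def BijGroup_def)
  show ?thesis
  proof (rule groupI)
    fix x assume "x \<in> carrier (semidirect_product H \<theta> N)"
    then obtain h n where x: "x = (h, n)" "h \<in> carrier H" "n \<in> carrier N"
      by (auto simp: semidirect_product_def)
    have "\<theta> (inv\<^bsub>H\<^esub> h) (inv\<^bsub>N\<^esub> n) \<otimes>\<^bsub>N\<^esub> \<theta> (inv\<^bsub>H\<^esub> h) n = \<one>\<^bsub>N\<^esub>"
      using mult[of "inv\<^bsub>H\<^esub> h" "inv\<^bsub>N\<^esub> n" n] x
        hom_one[OF aut[of "inv\<^bsub>H\<^esub> h"] N.is_group N.is_group]
      by (simp del: T.hom_inv)
    then show "\<exists>y \<in> carrier (semidirect_product H \<theta> N).
        y \<otimes>\<^bsub>semidirect_product H \<theta> N\<^esub> x = \<one>\<^bsub>semidirect_product H \<theta> N\<^esub>"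
      using x by (intro bexI[of _ "(inv\<^bsub>H\<^esub> h, \<theta> (inv\<^bsub>H\<^esub> h) (inv\<^bsub>N\<^esub> n))"])
        (auto simp: semidirect_product_def closed simp del: T.hom_inv)
  qed (auto simp: semidirect_product_def closed mult comp one H.m_assoc N.m_assoc
      simp del: T.hom_mult T.hom_one)
qed

lemma factor_perm_hom:
  assumes P: "permutation_group P" and G: "group G"
    and e: "bij_betw e {1..card (points P)} (points P)"
  shows "factor_perm P e G \<in> hom (grp P) (AutoGroup (direct_power (card (points P)) G))"
proof -
  define n where "n = card (points P)"
  define N where "N = direct_power n G"
  define s where "s h i = inv_into {1..n} e (act P (e i) h)" for h i
  interpret H: group "grp P" using P by (simp add: permutation_group_def)
  interpret G: group G by fact
  have e': "bij_betw e {1..n} (points P)" using e by (simp add: n_def)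
  have ei: "e i \<in> points P" if "i \<in> {1..n}" for i
    using e' that by (auto simp: bij_betw_def)
  have es: "e (s h i) = act P (e i) h" "s h i \<in> {1..n}"
    if "h \<in> carrier (grp P)" "i \<in> {1..n}" for h i
  proof -
    have "act P (e i) h \<in> e ` {1..n}"
      using P ei that e' by (auto simp: permutation_group_def bij_betw_def)
    then show "e (s h i) = act P (e i) h" "s h i \<in> {1..n}"
      unfolding s_def by (rule f_inv_into_f, rule inv_into_into)
  qed
  have ss: "s k (s h i) = s (h \<otimes>\<^bsub>grp P\<^esub> k) i"
    if "h \<in> carrier (grp P)" "k \<in> carrier (grp P)" "i \<in> {1..n}" for h k i
    using P that es[of h i] ei by (simp add: s_def[of k] s_def[of "h \<otimes>\<^bsub>grp P\<^esub> k"] permutation_group_def)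
  have s1: "s \<one>\<^bsub>grp P\<^esub> i = i" if "i \<in> {1..n}" for i
  proof -
    have "act P (e i) \<one>\<^bsub>grp P\<^esub> = e i" using P ei[OF that] by (simp add: permutation_group_def)
    then show ?thesis using e' that by (simp add: s_def bij_betw_def inv_into_f_f)
  qed
  have T: "factor_perm P e G h = (\<lambda>g \<in> carrier N. \<lambda>i \<in> {1..n}. g (s h i))" for h
    by (simp add: factor_perm_def N_def n_def s_def Let_def)
  have N: "carrier N = ({1..n} \<rightarrow>\<^sub>E carrier G)"
    by (simp add: N_def direct_power_def)
  have cl: "factor_perm P e G h g \<in> carrier N" if "h \<in> carrier (grp P)" "g \<in> carrier N" for h g
    using that es(2)[OF that(1)] by (auto simp: T N PiE_def Pi_def)
  have comp: "factor_perm P e G h (factor_perm P e G k g) = factor_perm P e G (h \<otimes>\<^bsub>grp P\<^esub> k) g"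
    if "h \<in> carrier (grp P)" "k \<in> carrier (grp P)" "g \<in> carrier N" for h k g
  proof -
    have "factor_perm P e G k g \<in> carrier N" using cl that by blast
    then have "factor_perm P e G h (factor_perm P e G k g) =
        (\<lambda>i \<in> {1..n}. (factor_perm P e G k g) (s h i))" by (simp add: T)
    also have "\<dots> = (\<lambda>i \<in> {1..n}. g (s (h \<otimes>\<^bsub>grp P\<^esub> k) i))"
    proof (rule restrict_ext)
      fix i assume "i \<in> {1..n}"
      then show "(factor_perm P e G k g) (s h i) = g (s (h \<otimes>\<^bsub>grp P\<^esub> k) i)"
        using that es(2)[OF that(1)] ss[OF that(1,2)] unfolding T by simp
    qed
    also have "\<dots> = factor_perm P e G (h \<otimes>\<^bsub>grp P\<^esub> k) g" using that by (simp add: T)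
    finally show ?thesis .
  qed
  have one: "factor_perm P e G \<one>\<^bsub>grp P\<^esub> g = g" if "g \<in> carrier N" for g
  proof -
    have "(\<lambda>i \<in> {1..n}. g (s \<one>\<^bsub>grp P\<^esub> i)) = (\<lambda>i \<in> {1..n}. g i)"
      by (rule restrict_ext) (simp add: s1)
    also have "\<dots> = g" using that by (simp add: N)
    finally show ?thesis using that by (simp add: T)
  qed
  have aut: "factor_perm P e G h \<in> auto N" if h: "h \<in> carrier (grp P)" for h
  proof -
    have "factor_perm P e G h (a \<otimes>\<^bsub>N\<^esub> b) = factor_perm P e G h a \<otimes>\<^bsub>N\<^esub> factor_perm P e G h b"
      if ab: "a \<in> carrier N" "b \<in> carrier N" for a b
    proof -
      have "a \<otimes>\<^bsub>N\<^esub> b \<in> carrier N"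
        using ab group_direct_power[OF G, of n] by (simp add: N_def group.is_monoid monoid.m_closed)
      then show ?thesis using ab es(2)[OF h]
        by (auto simp: T) (auto simp: N_def direct_power_def)
    qed
    moreover have "bij_betw (factor_perm P e G h) (carrier N) (carrier N)"
      by (rule bij_betw_byWitness[where f' = "factor_perm P e G (inv\<^bsub>grp P\<^esub> h)"])
        (use h in \<open>auto simp: comp one cl\<close>)
    moreover have "factor_perm P e G h \<in> extensional (carrier N)" by (simp add: T)
    ultimately show ?thesis using cl[OF h] by (auto simp: auto_def Bij_def hom_def)
  qed
  have "factor_perm P e G \<in> hom (grp P) (AutoGroup N)"
  proof (rule homI)
    fix h k assume hk: "h \<in> carrier (grp P)" "k \<in> carrier (grp P)"
    have "factor_perm P e G (h \<otimes>\<^bsub>grp P\<^esub> k) g =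
        compose (carrier N) (factor_perm P e G h) (factor_perm P e G k) g" for g
      using hk by (cases "g \<in> carrier N") (simp_all add: compose_def comp, simp add: T)
    then show "factor_perm P e G (h \<otimes>\<^bsub>grp P\<^esub> k) =
        factor_perm P e G h \<otimes>\<^bsub>AutoGroup N\<^esub> factor_perm P e G k"
      using aut hk by (auto simp: AutoGroup_def BijGroup_def auto_def)
  qed (simp add: AutoGroup_def aut)
  then show ?thesis by (simp add: N_def n_def)
qed

lemma group_wreath_product:
  assumes "permutation_group P" "group G" "bij_betw e {1..card (points P)} (points P)"
  shows "group (wreath_product P e G)"
  unfolding wreath_product_def
  using assms factor_perm_hom[OF assms]
  by (intro group_semidirect_product group_direct_power) (auto simp: permutation_group_def)

lemma permutation_group_cascade_product:
  assumes "permutation_group P" "permutation_group Q"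
  shows "permutation_group (cascade_product P Q)"
proof -
  interpret H: group "grp P" using assms by (simp add: permutation_group_def)
  interpret G: group "grp Q" using assms by (simp add: permutation_group_def)
  have P: "\<And>x h. x \<in> points P \<Longrightarrow> h \<in> carrier (grp P) \<Longrightarrow> act P x h \<in> points P"
      "\<And>x. x \<in> points P \<Longrightarrow> act P x \<one>\<^bsub>grp P\<^esub> = x"
      "\<And>x h k. x \<in> points P \<Longrightarrow> h \<in> carrier (grp P) \<Longrightarrow> k \<in> carrier (grp P) \<Longrightarrow>
        act P (act P x h) k = act P x (h \<otimes>\<^bsub>grp P\<^esub> k)"
    using assms(1) by (auto simp: permutation_group_def)
  have mem: "f x \<in> carrier (grp Q)"
    if "f \<in> points P \<rightarrow>\<^sub>E carrier (grp Q)" "x \<in> points P" for f x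
    using that by (rule PiE_mem)
  let ?C = "grp (cascade_product P Q)"
  have "group ?C"
  proof (rule groupI)
    fix a assume "a \<in> carrier ?C"
    then obtain h f where a: "a = (h, f)" "h \<in> carrier (grp P)" "f \<in> points P \<rightarrow>\<^sub>E carrier (grp Q)"
      by (auto simp: cascade_product_def)
    then show "\<exists>b \<in> carrier ?C. b \<otimes>\<^bsub>?C\<^esub> a = \<one>\<^bsub>?C\<^esub>"
      by (intro bexI[of _ "(inv\<^bsub>grp P\<^esub> h,
            \<lambda>x \<in> points P. inv\<^bsub>grp Q\<^esub> (f (act P x (inv\<^bsub>grp P\<^esub> h))))"])
        (auto simp: cascade_product_def P mem intro!: restrict_ext G.inv_closed G.l_inv)
  next
    fix a b c assume "a \<in> carrier ?C" "b \<in> carrier ?C" "c \<in> carrier ?C"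
    then show "a \<otimes>\<^bsub>?C\<^esub> b \<otimes>\<^bsub>?C\<^esub> c = a \<otimes>\<^bsub>?C\<^esub> (b \<otimes>\<^bsub>?C\<^esub> c)"
      by (auto simp: cascade_product_def P mem H.m_assoc
          intro!: restrict_ext G.m_assoc)
  next
    fix a assume "a \<in> carrier ?C"
    then obtain h f where a: "a = (h, f)" "h \<in> carrier (grp P)" "f \<in> points P \<rightarrow>\<^sub>E carrier (grp Q)"
      by (auto simp: cascade_product_def)
    have "(\<lambda>x \<in> points P. \<one>\<^bsub>grp Q\<^esub> \<otimes>\<^bsub>grp Q\<^esub> f (act P x \<one>\<^bsub>grp P\<^esub>)) = (\<lambda>x \<in> points P. f x)"
      using a by (intro restrict_ext) (auto simp: P intro!: G.l_one)
    then show "\<one>\<^bsub>?C\<^esub> \<otimes>\<^bsub>?C\<^esub> a = a"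
      using a by (auto simp: cascade_product_def cong: restrict_cong)
  qed (auto simp: cascade_product_def P mem intro!: G.m_closed)
  moreover have "act Q y \<one>\<^bsub>grp Q\<^esub> = y" if "y \<in> points Q" for y
    using assms(2) that by (auto simp: permutation_group_def)
  moreover have "act Q y g \<in> points Q" if "y \<in> points Q" "g \<in> carrier (grp Q)" for y g
    using assms(2) that by (auto simp: permutation_group_def)
  moreover have "act Q (act Q y g) k = act Q y (g \<otimes>\<^bsub>grp Q\<^esub> k)"
    if "y \<in> points Q" "g \<in> carrier (grp Q)" "k \<in> carrier (grp Q)" for y g k
    using assms(2) that by (auto simp: permutation_group_def)
  ultimately show ?thesis
    unfolding permutation_group_def by (auto simp: cascade_product_def P mem)
qed

end

theory Submission
  imports Defs
begin

text \<open>
  Both groups consist of pairs of an element \<open>h\<close> of \<open>H\<close> and a family of elements of \<open>G\<close>. The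
  families are indexed by \<open>{1..n}\<close> in the wreath product and by the points of \<open>X\<close> in the
  cascade product, so the isomorphism keeps \<open>h\<close> and transports the family along the numbering
  \<open>e\<close>: \<open>g\<close> becomes \<open>x \<mapsto> g (e\<^sup>-\<^sup>1 x)\<close>. This is bijective because \<open>e\<close> is
  (\<open>bij_betw_reindex\<close>).

  Multiplicativity rests on the right action in the definition of \<open>\<theta>\<close>: the entry of
  \<open>\<theta>\<^sub>h g\<close> at the index of \<open>x\<close> is the entry of \<open>g\<close> at the index of \<open>x\<^sup>h\<close>, so
  \<open>g \<mapsto> \<theta>\<^sub>h g\<close> becomes \<open>f \<mapsto> (x \<mapsto> f (x\<^sup>h))\<close> (\<open>reindex_factor_perm\<close>), which is the twist
  in the product of cascades.
\<close>

definition reindex :: "('i \<Rightarrow> 'x) \<Rightarrow> 'i set \<Rightarrow> 'x set \<Rightarrow> ('i \<Rightarrow> 'g) \<Rightarrow> ('x \<Rightarrow> 'g)" where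
  "reindex e I A g = (\<lambda>x \<in> A. g (inv_into I e x))"

lemma bij_betw_reindex:
  assumes e: "bij_betw e I A"
  shows "bij_betw (reindex e I A) (I \<rightarrow>\<^sub>E C) (A \<rightarrow>\<^sub>E C)"
proof (rule bij_betw_byWitness[where f' = "\<lambda>f. \<lambda>i \<in> I. f (e i)"])
  have ei: "e i \<in> A" "inv_into I e (e i) = i" if "i \<in> I" for i
    using e that by (auto simp: bij_betw_def)
  have inv: "inv_into I e x \<in> I" "e (inv_into I e x) = x" if "x \<in> A" for x
    using e that by (auto simp: bij_betw_def inv_into_into f_inv_into_f)
  show "\<forall>g \<in> I \<rightarrow>\<^sub>E C. (\<lambda>i \<in> I. reindex e I A g (e i)) = g"
    by (auto simp: reindex_def ei fun_eq_iff PiE_def extensional_def)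
  show "\<forall>f \<in> A \<rightarrow>\<^sub>E C. reindex e I A (\<lambda>i \<in> I. f (e i)) = f"
    by (auto simp: reindex_def inv fun_eq_iff PiE_def extensional_def)
  show "reindex e I A ` (I \<rightarrow>\<^sub>E C) \<subseteq> A \<rightarrow>\<^sub>E C"
    by (auto simp: reindex_def inv)
  show "(\<lambda>f. \<lambda>i \<in> I. f (e i)) ` (A \<rightarrow>\<^sub>E C) \<subseteq> I \<rightarrow>\<^sub>E C"
    by (auto simp: ei)
qed

lemma reindex_mult_direct_power:
  assumes "bij_betw e {1..n} A"
  shows "reindex e {1..n} A (g \<otimes>\<^bsub>direct_power n G\<^esub> k) =
    (\<lambda>x \<in> A. reindex e {1..n} A g x \<otimes>\<^bsub>G\<^esub> reindex e {1..n} A k x)"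
proof -
  have "inv_into {1..n} e x \<in> {1..n}" if "x \<in> A" for x
    using assms that by (metis bij_betw_def inv_into_into)
  then show ?thesis
    by (auto simp: reindex_def direct_power_def)
qed

text \<open>Permuting the direct factors by \<open>h\<close> is precomposition with \<open>x \<mapsto> x\<^sup>h\<close>, once tuples are
  read as functions on the points: the numbering occurs in \<open>\<theta>\<^sub>h\<close> only as the conjugate
  \<open>e\<^sup>-\<^sup>1 \<circ> h \<circ> e\<close>, and it cancels.\<close>

lemma reindex_factor_perm:
  assumes P: "permutation_group P" and e: "bij_betw e {1..card (points P)} (points P)"
    and h: "h \<in> carrier (grp P)" and g: "g \<in> carrier (direct_power (card (points P)) G)"
  defines "r \<equiv> reindex e {1..card (points P)} (points P)"
  shows "r (factor_perm P e G h g) = (\<lambda>x \<in> points P. r g (act P x h))"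
proof -
  let ?I = "{1..card (points P)}"
  have "inv_into ?I e x \<in> ?I" "e (inv_into ?I e x) = x" if "x \<in> points P" for x
    using e that by (metis bij_betw_def inv_into_into, metis bij_betw_def f_inv_into_f)
  moreover have "act P x h \<in> points P" if "x \<in> points P" for x
    using P h that by (simp add: permutation_group_def)
  ultimately show ?thesis
    using g unfolding r_def reindex_def factor_perm_def Let_def
    by (intro restrict_ext) simp
qed

theorem theorem3p3:
  fixes XH :: "('x, 'h) perm_group" and G :: "'g monoid" and YG :: "('y, 'g) perm_group"
    and n :: nat and e :: "nat \<Rightarrow> 'x"
  assumes "permutation_group XH"
    and "finite (points XH)"
    and "card (points XH) = n"
    and "bij_betw e {1..n} (points XH)"
    and "group G"
    and "permutation_group YG"
    and "grp YG = G"
  shows "wreath_product XH e G \<cong> grp (cascade_product XH YG)"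
proof -
  let ?W = "wreath_product XH e G" and ?C = "grp (cascade_product XH YG)"
  define r :: "(nat \<Rightarrow> 'g) \<Rightarrow> 'x \<Rightarrow> 'g" where "r = reindex e {1..n} (points XH)"
  have carrier_W: "carrier ?W = carrier (grp XH) \<times> ({1..n} \<rightarrow>\<^sub>E carrier G)"
    using assms(3) by (simp add: wreath_product_def semidirect_product_def direct_power_def)
  have carrier_C: "carrier ?C = carrier (grp XH) \<times> (points XH \<rightarrow>\<^sub>E carrier G)"
    using assms(7) by (simp add: cascade_product_def)
  have bij: "bij_betw (map_prod id r) (carrier ?W) (carrier ?C)"
    unfolding carrier_W carrier_C r_def
    by (intro bij_betw_map_prod bij_betw_id bij_betw_reindex assms(4))
  have mult: "map_prod id r (a \<otimes>\<^bsub>?W\<^esub> b) = map_prod id r a \<otimes>\<^bsub>?C\<^esub> map_prod id r b"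
    if ab: "a \<in> carrier ?W" "b \<in> carrier ?W" for a b
  proof -
    obtain h g k f where a: "a = (h, g)" and b: "b = (k, f)"
      and h: "h \<in> carrier (grp XH)" and f: "f \<in> carrier (direct_power n G)"
      using ab by (auto simp: carrier_W direct_power_def)
    have "r (factor_perm XH e G h f) = (\<lambda>x \<in> points XH. r f (act XH x h))"
      using reindex_factor_perm[of XH e h f G] assms(1,3,4) h f by (simp add: r_def)
    then have "r (g \<otimes>\<^bsub>direct_power n G\<^esub> factor_perm XH e G h f) =
        (\<lambda>x \<in> points XH. r g x \<otimes>\<^bsub>G\<^esub> r f (act XH x h))"
      using reindex_mult_direct_power[OF assms(4), of G g "factor_perm XH e G h f"]
      by (simp add: r_def cong: restrict_cong)
    then show ?thesis
      using assms(3,7)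
      by (simp add: a b wreath_product_def semidirect_product_def cascade_product_def)
  qed
  have "map_prod id r \<in> iso ?W ?C"
    using bij mult bij_betw_apply[OF bij] by (auto intro!: isoI homI)
  then show ?thesis by (rule is_isoI)
qed

end
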